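(* Let $q\in(0,1)$ and let $X\ge0$ be a (finite-valued) real random variable with CDF $F_X$ and characteristic function $\phi(\theta)=\mathbb{E}[e^{\mathrm{i}\theta X}]$. Let $W^R$ be a random variable having the stationary distribution of the GI/GI/1 waiting-time chain with resetting defined in the context. Then $W^R$ is a proper random variable with values in $[0,\infty)$, its CDF is $$F_{W^R}=q\mathbf{1}_{\mathbb{R}_+}+q(1-q)F_X+q(1-q)^2F_X*F_X+q(1-q)^3F_X*F_X*F_X+\cdots,$$ and its characteristic function $\psi(\theta)=\mathbb{E}[e^{\mathrm{i}\theta W^R}]$ is $$\psi(\theta)=q\sum_{k=0}^\infty(1-q)^k(\phi(\theta))^k=\frac{q}{1-(1-q)\phi(\theta)},\qquad\theta\in\mathbb{R}.$$
   Context: $\mathbb{R}_+=[0,\infty)$, $Y^+=\max(0,Y)$, and $G_1*G_2(t)=\int_{\mathbb{R}}G_1(t-y)\,dG_2(y)$ is the convolution of CDFs. "Proper" means finite-valued almost surely. The GI/GI/1 waiting-time chain with resetting is the discrete-time Markov chain $\{W^R_n\}_{n\ge0}$ on $\mathbb{R}_+$ given by $W^R_{n+1}=Z_{n+1}(W^R_n+X_n)^+$, where $\{X_n\}_{n\ge0}$ are i.i.d. copies of $X$, $\{Z_n\}_{n\ge1}$ are i.i.d. Bernoulli with $\mathbb{P}(Z_n=0)=q=1-\mathbb{P}(Z_n=1)$, and $W_0^R\ge0$, $\{X_n\}$, $\{Z_n\}$ are independent. This chain has a unique stationary distribution. *)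

theory Defs
  imports "HOL-Probability.Probability"
begin

text \<open>
  The waiting-time chain with resetting. Its values are taken in \<open>[0,\<infinity>]\<close> (inside \<open>ereal\<close>, where
  \<open>0 * \<infinity> = 0\<close>), so that finiteness of a stationary variable is a claim and not a consequence of its
  type. Started from a finite value it is the recursion on the reals (\<open>reset_chain_ereal\<close>).
\<close>

primrec reset_chain :: "ereal \<Rightarrow> (nat \<Rightarrow> real) \<Rightarrow> (nat \<Rightarrow> bool) \<Rightarrow> nat \<Rightarrow> ereal" where
  "reset_chain w0 x z 0 = w0"
| "reset_chain w0 x z (Suc n) = of_bool (z (Suc n)) * max 0 (reset_chain w0 x z n + ereal (x n))"

lemma reset_chain_ereal:
  assumes "v 0 = w0" and "\<And>n. v (Suc n) = of_bool (z (Suc n)) * max 0 (v n + x n)"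
  shows "reset_chain (ereal w0) x z n = ereal (v n)"
  by (induction n) (auto simp: assms max_def zero_ereal_def)

text \<open>
  Canonical probability space of the driving sequences: \<open>W\<^sub>0 \<sim> \<nu>\<close>, \<open>X\<^sub>n \<sim> \<mu>\<close> for \<open>n \<ge> 0\<close>, and
  \<open>Z\<^sub>n\<close> Bernoulli for \<open>n \<ge> 1\<close> with \<open>P(Z\<^sub>n = 0) = q\<close>, all independent.
\<close>

definition reset_chain_space ::
  "real \<Rightarrow> real measure \<Rightarrow> ereal measure \<Rightarrow> (ereal \<times> (nat \<Rightarrow> real) \<times> (nat \<Rightarrow> bool)) measure" where
  "reset_chain_space q \<mu> \<nu> =
     \<nu> \<Otimes>\<^sub>M (\<Pi>\<^sub>M n\<in>UNIV. \<mu>) \<Otimes>\<^sub>M (\<Pi>\<^sub>M n\<in>{1..}. measure_pmf (bernoulli_pmf (1 - q)))"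

definition reset_stationary :: "real \<Rightarrow> real measure \<Rightarrow> ereal measure \<Rightarrow> bool" where
  "reset_stationary q \<mu> \<nu> \<longleftrightarrow>
     prob_space \<nu> \<and> sets \<nu> = sets borel \<and> (AE w in \<nu>. 0 \<le> w) \<and>
     (\<forall>n. distr (reset_chain_space q \<mu> \<nu>) borel (\<lambda>(w0, x, z). reset_chain w0 x z n) = \<nu>)"

text \<open>Convolution of distribution functions, as a Lebesgue-Stieltjes integral.\<close>

definition cdf_conv :: "(real \<Rightarrow> real) \<Rightarrow> (real \<Rightarrow> real) \<Rightarrow> real \<Rightarrow> real" where
  "cdf_conv G1 G2 t = (LINT y|interval_measure G2. G1 (t - y))"

text \<open>\<open>F * \<dots> * F\<close> with \<open>k\<close> factors; the empty convolution is the CDF of the unit mass at \<open>0\<close>.\<close>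

fun cdf_conv_power :: "(real \<Rightarrow> real) \<Rightarrow> nat \<Rightarrow> real \<Rightarrow> real" where
  "cdf_conv_power F 0 = indicator {0..}"
| "cdf_conv_power F (Suc 0) = F"
| "cdf_conv_power F (Suc (Suc k)) = cdf_conv (cdf_conv_power F (Suc k)) F"

end

theory Submission
  imports Defs
begin

text \<open>
  One step of the stationary chain from \<open>\<infinity>\<close> stays there only if no reset occurs, so the atom at \<open>\<infinity>\<close>
  has mass \<open>p = (1 - q) p\<close>, that is \<open>p = 0\<close>. On finite values stationarity becomes the renewal
  equation \<open>\<rho> = q \<delta>\<^sub>0 + (1 - q) (\<rho> \<star> \<mu>)\<close> for the law \<open>\<rho>\<close> of the chain and the law \<open>\<mu>\<close> of \<open>X\<close>. Taking
  characteristic functions turns it into \<open>\<psi> = q + (1 - q) \<psi> \<phi>\<close>; iterating it for distribution functions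
  leaves after \<open>n\<close> steps a remainder of size at most \<open>(1 - q)\<^sup>n\<close>.
\<close>

section \<open>Convolution of distributions on the line\<close>

text \<open>Fubini on the product measure whose image under addition is \<open>A \<star> B\<close>;
  boundedness of \<open>f\<close> gives integrability. Characteristic functions and distribution
  functions of convolutions are both instances, with \<open>f\<close> an exponential or an
  indicator.\<close>

lemma integral_convolution:
  fixes f :: "real \<Rightarrow> 'b::{banach, second_countable_topology}"
  assumes "real_distribution A" "real_distribution B"
    and [measurable]: "f \<in> borel_measurable borel"
    and bound: "\<And>x. norm (f x) \<le> C"
  shows "integral\<^sup>L (A \<star> B) f = (\<integral>y. \<integral>x. f (x + y) \<partial>A \<partial>B)"
proof -
  interpret A: real_distribution A by fact
  interpret B: real_distribution B by fact
  interpret AB: pair_prob_space A B ..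
  have int: "integrable (A \<Otimes>\<^sub>M B) (\<lambda>(x, y). f (x + y))"
    by (rule AB.integrable_const_bound[where B=C]) (auto simp: bound case_prod_unfold)
  have "integral\<^sup>L (A \<star> B) f = (\<integral>(x, y). f (x + y) \<partial>(A \<Otimes>\<^sub>M B))"
    unfolding convolution_def by (subst integral_distr) (auto simp: case_prod_unfold)
  also have "\<dots> = (\<integral>y. \<integral>x. f (x + y) \<partial>A \<partial>B)"
    using AB.integral_snd[OF int] by simp
  finally show ?thesis .
qed

lemma real_distribution_convolution:
  assumes "real_distribution A" "real_distribution B"
  shows "real_distribution (A \<star> B)"
proof -
  interpret A: real_distribution A by fact
  interpret B: real_distribution B by fact
  interpret AB: pair_prob_space A B ..
  show ?thesis
    unfolding convolution_def by (rule AB.real_distribution_distr) simp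
qed

lemma char_convolution:
  assumes "real_distribution A" "real_distribution B"
  shows "char (A \<star> B) \<theta> = char A \<theta> * char B \<theta>"
proof -
  have "char (A \<star> B) \<theta> = (\<integral>y. \<integral>x. iexp (\<theta> * (x + y)) \<partial>A \<partial>B)"
    unfolding char_def by (rule integral_convolution[OF assms, where C=1]) auto
  also have "\<dots> = (\<integral>y. \<integral>x. iexp (\<theta> * x) * iexp (\<theta> * y) \<partial>A \<partial>B)"
    by (simp add: distrib_left exp_add)
  also have "\<dots> = char A \<theta> * char B \<theta>"
    unfolding char_def by simp
  finally show ?thesis .
qed

text \<open>The outer integral runs over the second factor, matching the order in
  \<open>cdf_conv\<close>.\<close>

lemma cdf_convolution:
  assumes "real_distribution A" "real_distribution B"
  shows "cdf (A \<star> B) t = (\<integral>y. cdf A (t - y) \<partial>B)"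
proof -
  interpret A: real_distribution A by fact
  interpret AB: real_distribution "A \<star> B"
    by (rule real_distribution_convolution[OF assms])
  have "cdf (A \<star> B) t = (\<integral>x. indicator {..t} x \<partial>(A \<star> B))"
    unfolding cdf_def by simp
  also have "\<dots> = (\<integral>y. \<integral>x. indicator {..t} (x + y) \<partial>A \<partial>B)"
    by (rule integral_convolution[OF assms, where C=1]) (auto simp: indicator_def)
  also have "\<dots> = (\<integral>y. \<integral>x. indicator {..t - y} x \<partial>A \<partial>B)"
    by (intro Bochner_Integration.integral_cong) (auto simp: indicator_def)
  also have "\<dots> = (\<integral>y. cdf A (t - y) \<partial>B)"
    unfolding cdf_def by simp
  finally show ?thesis .
qed

text \<open>A law is determined by its distribution function. This turns the Lebesgue-Stieltjes
  integral in \<open>cdf_conv\<close> into an integral against the law itself.\<close>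

lemma interval_measure_cdf:
  assumes "real_distribution B"
  shows "interval_measure (cdf B) = B"
proof -
  interpret B: real_distribution B by fact
  have "real_distribution (interval_measure (cdf B))"
    by (intro real_distribution_interval_measure B.cdf_nondecreasing B.cdf_is_right_cont
        B.cdf_lim_at_bot B.cdf_lim_at_top_prob)
  moreover have "cdf (interval_measure (cdf B)) = cdf B"
    by (intro cdf_interval_measure B.cdf_nondecreasing B.cdf_is_right_cont B.cdf_lim_at_bot)
  ultimately show ?thesis
    using cdf_unique assms by blast
qed

lemma cdf_conv_cdf:
  assumes "real_distribution A" "real_distribution B"
  shows "cdf_conv (cdf A) (cdf B) = cdf (A \<star> B)"
  unfolding cdf_conv_def interval_measure_cdf[OF assms(2)]
  by (rule ext) (rule cdf_convolution[OF assms, symmetric])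

text \<open>Built up from the unit mass at \<open>0\<close>, hence without the separate clause for
  one factor that \<open>cdf_conv_power\<close> has; \<open>convolution_return_0\<close> reconciles
  the two.\<close>

primrec convolution_power :: "real measure \<Rightarrow> nat \<Rightarrow> real measure" where
  "convolution_power \<mu> 0 = return borel 0"
| "convolution_power \<mu> (Suc k) = (convolution_power \<mu> k \<star> \<mu>)"

lemma real_distribution_return: "real_distribution (return borel x)"
  by (auto simp: real_distribution_def real_distribution_axioms_def intro: prob_space_return)

lemma real_distribution_convolution_power:
  "real_distribution \<mu> \<Longrightarrow> real_distribution (convolution_power \<mu> k)"
  by (induction k) (auto intro: real_distribution_return real_distribution_convolution)

lemma cdf_return: "cdf (return borel x) t = indicator {x..} t"
  by (auto simp: cdf_def measure_return indicator_def)

lemma convolution_return_0: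
  assumes "real_distribution \<mu>"
  shows "(return borel 0 \<star> \<mu>) = \<mu>"
proof (rule cdf_unique)
  interpret real_distribution \<mu> by fact
  show "cdf (return borel 0 \<star> \<mu>) = cdf \<mu>"
  proof
    fix t
    have "cdf (return borel 0 \<star> \<mu>) t = (\<integral>y. indicator {..t} y \<partial>\<mu>)"
      unfolding cdf_convolution[OF real_distribution_return assms] cdf_return
      by (intro Bochner_Integration.integral_cong) (auto simp: indicator_def)
    then show "cdf (return borel 0 \<star> \<mu>) t = cdf \<mu> t"
      by (simp add: cdf_def)
  qed
qed (use assms in \<open>auto intro: real_distribution_convolution real_distribution_return\<close>)

lemma cdf_conv_power_cdf:
  assumes "real_distribution \<mu>"
  shows "cdf_conv_power (cdf \<mu>) k = cdf (convolution_power \<mu> k)"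
proof (induction "cdf \<mu>" k rule: cdf_conv_power.induct)
  case 1
  show ?case by (auto simp: cdf_return)
next
  case 2
  show ?case by (simp add: convolution_return_0[OF assms])
next
  case (3 k)
  then show ?case
    using cdf_conv_cdf[OF real_distribution_convolution_power[OF assms, of "Suc k"] assms] by simp
qed

section \<open>The renewal equation\<close>

text \<open>Convolution with \<mu> integrates \<open>cdf D (t - y)\<close> over \<open>y\<close> and
  is therefore linear in the distribution function of the left factor. Expressing the mixture
  through distribution functions avoids forming sums of measures.\<close>

lemma cdf_renewal_step:
  assumes \<mu>: "real_distribution \<mu>" and A: "real_distribution A" and B: "real_distribution B"
    and C: "real_distribution C"
    and eq: "\<And>t. cdf A t = q * cdf B t + r * cdf C t"
  shows "cdf (A \<star> \<mu>) t = q * cdf (B \<star> \<mu>) t + r * cdf (C \<star> \<mu>) t"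
proof -
  interpret \<mu>: real_distribution \<mu> by fact
  have int: "integrable \<mu> (\<lambda>y. cdf D (t - y))" if "real_distribution D" for D
  proof -
    interpret D: real_distribution D by fact
    have [measurable]: "cdf D \<in> borel_measurable borel"
      by (intro borel_measurable_mono monoI D.cdf_nondecreasing)
    show ?thesis
      by (rule \<mu>.integrable_const_bound[where B=1])
         (auto simp: D.cdf_nonneg D.cdf_bounded_prob)
  qed
  show ?thesis
    using int[OF B] int[OF C] by (simp add: cdf_convolution A B C \<mu> eq)
qed

lemma renewal_cdf_sums:
  assumes q: "0 < q" "q < 1"
    and \<mu>: "real_distribution \<mu>" and \<rho>: "real_distribution \<rho>"
    and eq: "\<And>t. cdf \<rho> t = q * cdf (return borel 0) t + (1 - q) * cdf (\<rho> \<star> \<mu>) t"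
  shows "(\<lambda>k. q * (1 - q) ^ k * cdf (convolution_power \<mu> k) t) sums cdf \<rho> t"
proof -
  \<comment> \<open>\<open>R n\<close> is \<rho> convolved \<open>n\<close> times on the right with
    \<mu>: the law in the remainder after \<open>n\<close> substitutions.\<close>
  define R where "R n = ((\<lambda>\<sigma>. \<sigma> \<star> \<mu>) ^^ n) \<rho>" for n
  have R: "real_distribution (R n)" for n
    by (induction n) (auto simp: R_def \<rho> intro: real_distribution_convolution \<mu>)
  \<comment> \<open>The renewal equation convolved \<open>n\<close> times with \<mu>; the unit mass
    turns into the \<open>n\<close>-th convolution power.\<close>
  have R_eq: "cdf (R n) t = q * cdf (convolution_power \<mu> n) t + (1 - q) * cdf (R (Suc n)) t" for n t
  proof (induction n arbitrary: t)
    case 0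
    show ?case using eq by (simp add: R_def)
  next
    case (Suc n)
    show ?case
      using cdf_renewal_step[OF \<mu> R real_distribution_convolution_power[OF \<mu>] R Suc.IH]
      by (simp add: R_def)
  qed
  \<comment> \<open>Telescoping: by \<open>R_eq\<close> the \<open>n\<close>-th summand is exactly
    the decrease of the remainder from \<open>n\<close> to \<open>Suc n\<close>.\<close>
  have partial: "(\<Sum>k<n. q * (1 - q) ^ k * cdf (convolution_power \<mu> k) t) =
      cdf \<rho> t - (1 - q) ^ n * cdf (R n) t" for n
  proof (induction n)
    case (Suc n)
    then show ?case using R_eq[of n t] by (simp add: algebra_simps)
  qed (simp add: R_def)
  have "(\<lambda>n. (1 - q) ^ n * cdf (R n) t) \<longlonglongrightarrow> 0"
  proof (rule tendsto_sandwich[OF _ _ tendsto_const])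
    show "(\<lambda>n. (1 - q) ^ n) \<longlonglongrightarrow> 0"
      using q by (intro LIMSEQ_power_zero) auto
    interpret R: real_distribution "R n" for n by (rule R)
    show "\<forall>\<^sub>F n in sequentially. 0 \<le> (1 - q) ^ n * cdf (R n) t"
      using q R.cdf_nonneg by auto
    show "\<forall>\<^sub>F n in sequentially. (1 - q) ^ n * cdf (R n) t \<le> (1 - q) ^ n"
      using q R.cdf_bounded_prob by (auto intro!: mult_left_le)
  qed
  from tendsto_diff[OF tendsto_const this] show ?thesis
    unfolding sums_def partial by simp
qed

text \<open>The equation is linear in \<psi>, and \<open>norm (of_real (1 - q) * \<phi>)\<close> is
  at most \<open>1 - q < 1\<close>. So the denominator does not vanish and the quotient expands into
  a geometric series.\<close>

lemma geometric_mixture_char: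
  fixes \<phi> \<psi> :: complex
  assumes q: "0 < q" "q < 1" and \<phi>: "norm \<phi> \<le> 1"
    and eq: "\<psi> = of_real q + of_real (1 - q) * (\<psi> * \<phi>)"
  shows "summable (\<lambda>k. of_real (1 - q) ^ k * \<phi> ^ k)"
    and "\<psi> = of_real q * (\<Sum>k. of_real (1 - q) ^ k * \<phi> ^ k)"
    and "\<psi> = of_real q / (1 - of_real (1 - q) * \<phi>)"
proof -
  let ?z = "of_real (1 - q) * \<phi>"
  have "norm ?z = (1 - q) * norm \<phi>"
    unfolding norm_mult norm_of_real using q by simp
  also have "\<dots> \<le> 1 - q"
    using q \<phi> by (intro mult_left_le) auto
  also have "\<dots> < 1"
    using q by simp
  finally have z: "norm ?z < 1" .
  show "summable (\<lambda>k. of_real (1 - q) ^ k * \<phi> ^ k)"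
    using summable_geometric[OF z] by (simp add: power_mult_distrib)
  have "\<psi> * (1 - ?z) = of_real q"
    using eq by (simp add: algebra_simps)
  moreover have "1 - ?z \<noteq> 0"
    using z by (metis eq_iff_diff_eq_0 norm_one order_less_irrefl)
  ultimately show quot: "\<psi> = of_real q / (1 - ?z)"
    by (metis nonzero_mult_div_cancel_right)
  show "\<psi> = of_real q * (\<Sum>k. of_real (1 - q) ^ k * \<phi> ^ k)"
    unfolding quot power_mult_distrib[symmetric] suminf_geometric[OF z] by simp
qed

section \<open>Stationarity\<close>

text \<open>One transition depends on the driving sequences only through \<open>x 0\<close> and
  \<open>z 1\<close>; splitting on \<open>z 1\<close> separates the reset, of weight
  \<open>q\<close>, from the ordinary step. The general Banach target lets one identity serve real
  indicators and complex exponentials.\<close>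

lemma reset_stationary_integral:
  fixes f :: "ereal \<Rightarrow> 'b::{banach, second_countable_topology}"
  assumes q: "0 \<le> q" "q \<le> 1" and "real_distribution \<mu>"
    and stat: "reset_stationary q \<mu> \<nu>"
    and [measurable]: "f \<in> borel_measurable borel" and bound: "\<And>w. norm (f w) \<le> C"
  shows "integral\<^sup>L \<nu> f =
    q *\<^sub>R f 0 + (1 - q) *\<^sub>R (\<integral>(w, x). f (max 0 (w + ereal x)) \<partial>(\<nu> \<Otimes>\<^sub>M \<mu>))"
proof -
  let ?b = "measure_pmf (bernoulli_pmf (1 - q))"
  let ?X = "\<Pi>\<^sub>M n\<in>(UNIV :: nat set). \<mu>" and ?Z = "\<Pi>\<^sub>M n\<in>{1::nat..}. ?b"
  \<comment> \<open>Since \<open>0 * \<infinity> = 0\<close> in \<open>ereal\<close>, a reset sends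
    even an infinite state to \<open>0\<close>.\<close>
  let ?step = "\<lambda>(w, x, z). of_bool z * max 0 (w + ereal x) :: ereal"
  interpret \<mu>: real_distribution \<mu> by fact
  interpret \<nu>: prob_space \<nu> using stat by (simp add: reset_stationary_def)
  have [measurable_cong]: "sets \<nu> = sets borel"
    using stat by (simp add: reset_stationary_def)
  interpret X: prob_space ?X by (intro prob_space_PiM \<mu>.prob_space_axioms)
  interpret Z: prob_space ?Z by (intro prob_space_PiM measure_pmf.prob_space_axioms)
  interpret XZ: pair_prob_space ?X ?Z ..
  interpret \<mu>b: pair_prob_space \<mu> ?b ..
  interpret \<nu>\<mu>: pair_prob_space \<nu> \<mu> ..
  interpret \<nu>\<mu>b: pair_prob_space \<nu> "\<mu> \<Otimes>\<^sub>M ?b" ..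
  \<comment> \<open>The increments are indexed from \<open>0\<close> and the resets from
    \<open>1\<close>, so the first transition reads coordinate \<open>0\<close> of one product and
    coordinate \<open>1\<close> of the other.\<close>
  have X0: "distr ?X \<mu> (\<lambda>x. x 0) = \<mu>"
    by (rule distr_PiM_component) (auto intro: \<mu>.prob_space_axioms)
  have Z1: "distr ?Z ?b (\<lambda>z. z 1) = ?b"
    by (rule distr_PiM_component) (auto intro: measure_pmf.prob_space_axioms)
  have X0_meas[measurable]: "(\<lambda>x. x 0) \<in> measurable ?X \<mu>" by simp
  have Z1_meas[measurable]: "(\<lambda>z. z 1) \<in> measurable ?Z ?b"
    by (rule measurable_component_singleton) simp
  have XZ_meas: "(\<lambda>(x, z). (x 0, z 1)) \<in> measurable (?X \<Otimes>\<^sub>M ?Z) (\<mu> \<Otimes>\<^sub>M ?b)"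
    by measurable
  have XZ: "distr (?X \<Otimes>\<^sub>M ?Z) (\<mu> \<Otimes>\<^sub>M ?b) (\<lambda>(x, z). (x 0, z 1)) = \<mu> \<Otimes>\<^sub>M ?b"
    using pair_measure_distr[OF X0_meas Z1_meas, unfolded X0 Z1, OF measure_pmf.sigma_finite_measure_axioms]
    by (rule sym)
  \<comment> \<open>Initial value, first increment and first reset variable remain independent with
    their own laws, which reduces the infinite products to a triple product.\<close>
  have proj: "distr (reset_chain_space q \<mu> \<nu>) (\<nu> \<Otimes>\<^sub>M \<mu> \<Otimes>\<^sub>M ?b) (\<lambda>(w, x, z). (w, x 0, z 1)) =
      \<nu> \<Otimes>\<^sub>M \<mu> \<Otimes>\<^sub>M ?b"
    using pair_measure_distr[OF measurable_ident_sets[OF refl] XZ_meas, unfolded XZ, of \<nu>]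
    by (simp add: distr_id \<mu>b.P.sigma_finite_measure_axioms reset_chain_space_def case_prod_unfold)
  have step_meas[measurable]: "?step \<in> borel_measurable (\<nu> \<Otimes>\<^sub>M \<mu> \<Otimes>\<^sub>M ?b)"
    by measurable
  have proj_meas: "(\<lambda>(w, x, z). (w, x 0, z 1)) \<in>
      measurable (reset_chain_space q \<mu> \<nu>) (\<nu> \<Otimes>\<^sub>M \<mu> \<Otimes>\<^sub>M ?b)"
    unfolding reset_chain_space_def by measurable
  have "\<nu> = distr (reset_chain_space q \<mu> \<nu>) borel (\<lambda>(w0, x, z). reset_chain w0 x z 1)"
    using stat unfolding reset_stationary_def by metis
  also have "\<dots> = distr (reset_chain_space q \<mu> \<nu>) borel (?step \<circ> (\<lambda>(w, x, z). (w, x 0, z 1)))"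
    by (simp add: comp_def case_prod_unfold)
  also have "\<dots> = distr (\<nu> \<Otimes>\<^sub>M \<mu> \<Otimes>\<^sub>M ?b) borel ?step"
    using distr_distr[OF step_meas proj_meas, unfolded proj] by (rule sym)
  finally have \<nu>_eq: "\<nu> = distr (\<nu> \<Otimes>\<^sub>M \<mu> \<Otimes>\<^sub>M ?b) borel ?step" .
  have intb: "integrable (\<nu> \<Otimes>\<^sub>M \<mu> \<Otimes>\<^sub>M ?b) (\<lambda>u. f (?step u))"
    by (rule \<nu>\<mu>b.integrable_const_bound[where B=C]) (auto simp: bound)
  have intb': "integrable (\<mu> \<Otimes>\<^sub>M ?b) (\<lambda>(x, z). f (?step (w, x, z)))" for w
    by (rule \<mu>b.integrable_const_bound[where B=C]) (auto simp: bound case_prod_unfold)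
  have int: "integrable (\<nu> \<Otimes>\<^sub>M \<mu>) (\<lambda>(w, x). f (max 0 (w + ereal x)))"
    by (rule \<nu>\<mu>.integrable_const_bound[where B=C]) (auto simp: bound case_prod_unfold)
  have int_x: "integrable \<mu> (\<lambda>x. f (max 0 (w + ereal x)))" for w
    by (rule \<mu>.integrable_const_bound[where B=C]) (auto simp: bound)
  have int_w: "integrable \<nu> (\<lambda>w. \<integral>x. f (max 0 (w + ereal x)) \<partial>\<mu>)"
    using \<nu>\<mu>.integrable_fst'[OF int] by simp
  have "integral\<^sup>L \<nu> f = (\<integral>u. f (?step u) \<partial>(\<nu> \<Otimes>\<^sub>M \<mu> \<Otimes>\<^sub>M ?b))"
    by (subst \<nu>_eq, subst integral_distr) auto
  also have "\<dots> = (\<integral>w. \<integral>(x, z). f (?step (w, x, z)) \<partial>(\<mu> \<Otimes>\<^sub>M ?b) \<partial>\<nu>)"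
    using \<nu>\<mu>b.integral_fst'[OF intb] by (simp add: case_prod_unfold)
  also have "\<dots> = (\<integral>w. \<integral>x. \<integral>z. f (?step (w, x, z)) \<partial>?b \<partial>\<mu> \<partial>\<nu>)"
    using \<mu>b.integral_fst'[OF intb'] by (simp add: case_prod_unfold)
  \<comment> \<open>The Bernoulli integral is a two-term sum: \<open>False\<close> has mass
    \<open>1 - (1 - q) = q\<close> and yields \<open>f 0\<close>.\<close>
  also have "\<dots> = (\<integral>w. \<integral>x. q *\<^sub>R f 0 + (1 - q) *\<^sub>R f (max 0 (w + ereal x)) \<partial>\<mu> \<partial>\<nu>)"
    using q by (subst integral_measure_pmf[of UNIV]) (auto simp: UNIV_bool add.commute)
  also have "\<dots> = q *\<^sub>R f 0 + (1 - q) *\<^sub>R (\<integral>w. \<integral>x. f (max 0 (w + ereal x)) \<partial>\<mu> \<partial>\<nu>)"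
    using int_x int_w \<mu>.prob_space \<nu>.prob_space by simp
  also have "(\<integral>w. \<integral>x. f (max 0 (w + ereal x)) \<partial>\<mu> \<partial>\<nu>) =
      (\<integral>(w, x). f (max 0 (w + ereal x)) \<partial>(\<nu> \<Otimes>\<^sub>M \<mu>))"
    using \<nu>\<mu>.integral_fst'[OF int] by simp
  finally show ?thesis .
qed

lemma reset_stationary_finite:
  assumes q: "0 < q" "q \<le> 1" and "real_distribution \<mu>" and stat: "reset_stationary q \<mu> \<nu>"
  shows "AE w in \<nu>. w < \<infinity>"
proof -
  interpret \<mu>: real_distribution \<mu> by fact
  interpret \<nu>: prob_space \<nu> using stat by (simp add: reset_stationary_def)
  interpret \<nu>\<mu>: pair_prob_space \<nu> \<mu> ..
  have [measurable_cong]: "sets \<nu> = sets borel"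
    using stat by (simp add: reset_stationary_def)
  have [simp]: "space \<nu> = UNIV"
    using sets_eq_imp_space_eq[of \<nu> borel] stat by (simp add: reset_stationary_def)
  let ?f = "indicator {\<infinity>} :: ereal \<Rightarrow> real"
  \<comment> \<open>A finite increment moves no state into or out of \<open>\<infinity>\<close>; the
    value \<open>- \<infinity>\<close> is clipped to \<open>0\<close>.\<close>
  have eq: "?f (max 0 (w + ereal x)) = ?f w" for w x
    by (cases w) (auto simp: max_def indicator_def)
  have "measure \<nu> {\<infinity>} = integral\<^sup>L \<nu> ?f"
    by simp
  also have "\<dots> = (1 - q) * (\<integral>(w, x). ?f w \<partial>(\<nu> \<Otimes>\<^sub>M \<mu>))"
    by (subst reset_stationary_integral[OF _ _ assms(3) stat, where C=1])
       (use q in \<open>auto simp: eq split: split_indicator\<close>)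
  also have "(\<integral>(w, x). ?f w \<partial>(\<nu> \<Otimes>\<^sub>M \<mu>)) = (\<integral>w. \<integral>x. ?f w \<partial>\<mu> \<partial>\<nu>)"
  proof -
    have "integrable (\<nu> \<Otimes>\<^sub>M \<mu>) (\<lambda>(w, x). ?f w)"
      by (rule \<nu>\<mu>.integrable_const_bound[where B=1]) (auto simp: case_prod_unfold)
    from \<nu>\<mu>.integral_fst'[OF this] show ?thesis by simp
  qed
  also have "\<dots> = measure \<nu> {\<infinity>}"
    using \<mu>.prob_space by simp
  finally have "measure \<nu> {\<infinity>} = 0"
    using q by (simp add: algebra_simps)
  then have "{\<infinity>} \<in> null_sets \<nu>"
    by (auto simp: null_sets_def \<nu>.emeasure_eq_measure)
  then have "AE w in \<nu>. w \<notin> {\<infinity>}"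
    by (rule AE_not_in)
  then show ?thesis by simp
qed

text \<open>Almost surely the state is finite and nonnegative and the increment is nonnegative, so
  the positive part changes nothing and a step without reset is plain addition on the reals.
  \<open>real_of_ereal\<close> sends \<open>\<infinity>\<close> to \<open>0\<close>, which is
  harmless because that state has mass zero.\<close>

lemma reset_stationary_renewal:
  fixes f :: "real \<Rightarrow> 'b::{banach, second_countable_topology}"
  assumes q: "0 < q" "q \<le> 1" and \<mu>: "real_distribution \<mu>" and nonneg: "AE x in \<mu>. 0 \<le> x"
    and stat: "reset_stationary q \<mu> \<nu>"
    and [measurable]: "f \<in> borel_measurable borel" and bound: "\<And>x. norm (f x) \<le> C"
  defines "\<rho> \<equiv> distr \<nu> borel real_of_ereal"
  shows "integral\<^sup>L \<rho> f = q *\<^sub>R f 0 + (1 - q) *\<^sub>R integral\<^sup>L (\<rho> \<star> \<mu>) f"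
proof -
  interpret \<mu>: real_distribution \<mu> by fact
  interpret \<nu>: prob_space \<nu> using stat by (simp add: reset_stationary_def)
  interpret \<nu>\<mu>: pair_prob_space \<nu> \<mu> ..
  have [measurable_cong]: "sets \<nu> = sets borel"
    using stat by (simp add: reset_stationary_def)
  have fin: "AE w in \<nu>. 0 \<le> w \<and> w < \<infinity>"
    using reset_stationary_finite[OF q \<mu> stat] stat by (auto simp: reset_stationary_def)
  have "AE u in \<nu> \<Otimes>\<^sub>M \<mu>. 0 \<le> fst u \<and> fst u < \<infinity> \<and> 0 \<le> snd u"
  proof (rule \<nu>\<mu>.AE_pair_measure)
    show "AE w in \<nu>. AE x in \<mu>. 0 \<le> fst (w, x) \<and> fst (w, x) < \<infinity> \<and> 0 \<le> snd (w, x)"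
      using fin nonneg by auto
  qed measurable
  then have AE_eq: "AE u in \<nu> \<Otimes>\<^sub>M \<mu>.
      f (real_of_ereal (max 0 (fst u + ereal (snd u)))) = f (real_of_ereal (fst u) + snd u)"
  proof eventually_elim
    case (elim u)
    then show ?case by (cases "fst u") (auto simp: max_def zero_ereal_def)
  qed
  \<comment> \<open>Making the first coordinate real and then adding shows that
    \<open>\<rho> \<star> \<mu>\<close> is an image of the product on which the transition
    lives.\<close>
  have "(\<rho> \<star> \<mu>) = distr (distr (\<nu> \<Otimes>\<^sub>M \<mu>) (borel \<Otimes>\<^sub>M \<mu>) (\<lambda>(w, x). (real_of_ereal w, x))) borel (\<lambda>(x, y). x + y)"
    using pair_measure_distr[of real_of_ereal \<nu> borel "\<lambda>x. x" \<mu> \<mu>]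
    by (simp add: convolution_def \<rho>_def distr_id \<mu>.sigma_finite_measure_axioms)
  also have "\<dots> = distr (\<nu> \<Otimes>\<^sub>M \<mu>) borel (\<lambda>(w, x). real_of_ereal w + x)"
    by (subst distr_distr) (auto simp: comp_def case_prod_unfold)
  finally have conv: "(\<rho> \<star> \<mu>) = distr (\<nu> \<Otimes>\<^sub>M \<mu>) borel (\<lambda>(w, x). real_of_ereal w + x)" .
  have "integral\<^sup>L \<rho> f = (\<integral>w. f (real_of_ereal w) \<partial>\<nu>)"
    unfolding \<rho>_def by (rule integral_distr) auto
  also have "\<dots> = q *\<^sub>R f 0 + (1 - q) *\<^sub>R
      (\<integral>(w, x). f (real_of_ereal (max 0 (w + ereal x))) \<partial>(\<nu> \<Otimes>\<^sub>M \<mu>))"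
    by (subst reset_stationary_integral[OF _ _ \<mu> stat, where C=C]) (use q bound in auto)
  also have "(\<integral>(w, x). f (real_of_ereal (max 0 (w + ereal x))) \<partial>(\<nu> \<Otimes>\<^sub>M \<mu>)) =
      (\<integral>(w, x). f (real_of_ereal w + x) \<partial>(\<nu> \<Otimes>\<^sub>M \<mu>))"
    unfolding case_prod_unfold by (rule integral_cong_AE) (use AE_eq in auto)
  also have "\<dots> = integral\<^sup>L (\<rho> \<star> \<mu>) f"
    unfolding conv by (subst integral_distr) (auto simp: case_prod_unfold)
  finally show ?thesis .
qed

text \<open>With \<open>W\<close> valued in \<open>ereal\<close>, properness is a genuine claim. It
  also ensures that \<psi>, formed through \<open>real_of_ereal\<close>, is the characteristic
  function of \<open>W\<close> itself.\<close>

theorem theorem4p2: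
  fixes M :: "'a measure" and X :: "'a \<Rightarrow> real"
    and N :: "'b measure" and W :: "'b \<Rightarrow> ereal"
    and q :: real
  assumes "0 < q" and "q < 1"
    and "prob_space M" and "X \<in> borel_measurable M" and "AE \<omega> in M. 0 \<le> X \<omega>"
    and "prob_space N" and "W \<in> borel_measurable N"
    and "reset_stationary q (distr M borel X) (distr N borel W)"
  defines "\<phi> \<equiv> char (distr M borel X)"
    and "\<psi> \<equiv> char (distr N borel (\<lambda>\<omega>. real_of_ereal (W \<omega>)))"
  shows "(AE \<omega> in N. 0 \<le> W \<omega> \<and> W \<omega> < \<infinity>) \<and>
    (\<forall>t::real. (\<lambda>k. q * (1 - q) ^ k * cdf_conv_power (cdf (distr M borel X)) k t) sums
       measure N {\<omega> \<in> space N. W \<omega> \<le> ereal t}) \<and>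
    (\<forall>\<theta>::real. summable (\<lambda>k. of_real (1 - q) ^ k * \<phi> \<theta> ^ k) \<and>
       \<psi> \<theta> = of_real q * (\<Sum>k. of_real (1 - q) ^ k * \<phi> \<theta> ^ k) \<and>
       \<psi> \<theta> = of_real q / (1 - of_real (1 - q) * \<phi> \<theta>))"
proof -
  define \<mu> where "\<mu> = distr M borel X"
  define \<nu> where "\<nu> = distr N borel W"
  define \<rho> where "\<rho> = distr \<nu> borel real_of_ereal"
  note [measurable] = assms(4,7)
  interpret M: prob_space M by fact
  interpret N: prob_space N by fact
  have \<mu>: "real_distribution \<mu>"
    unfolding \<mu>_def by simp
  interpret \<mu>: real_distribution \<mu> by fact
  have nonneg: "AE x in \<mu>. 0 \<le> x"
    unfolding \<mu>_def using assms(5) by (simp add: AE_distr_iff)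
  have stat: "reset_stationary q \<mu> \<nu>"
    using assms(8) by (simp add: \<mu>_def \<nu>_def)
  have \<rho>_W: "\<rho> = distr N borel (\<lambda>\<omega>. real_of_ereal (W \<omega>))"
    unfolding \<rho>_def \<nu>_def by (subst distr_distr) (auto simp: comp_def)
  have \<rho>: "real_distribution \<rho>"
    unfolding \<rho>_W by simp
  interpret \<rho>: real_distribution \<rho> by fact
  have \<rho>\<mu>: "real_distribution (\<rho> \<star> \<mu>)"
    by (rule real_distribution_convolution[OF \<rho> \<mu>])
  interpret \<rho>\<mu>: real_distribution "\<rho> \<star> \<mu>" by fact
  \<comment> \<open>The target type stays general: the equation is applied at \<open>real\<close>
    for distribution functions and at \<open>complex\<close> for characteristic functions.\<close>
  have renewal: "integral\<^sup>L \<rho> f = q *\<^sub>R f 0 + (1 - q) *\<^sub>R integral\<^sup>L (\<rho> \<star> \<mu>) f"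
    if "f \<in> borel_measurable borel" "\<And>x. norm (f x) \<le> 1"
    for f :: "real \<Rightarrow> 'c::{banach, second_countable_topology}"
    unfolding \<rho>_def
    by (rule reset_stationary_renewal[OF _ _ \<mu> nonneg stat that]) (use assms(1,2) in auto)

  have "AE w in \<nu>. 0 \<le> w \<and> w < \<infinity>"
    using reset_stationary_finite[OF _ _ \<mu> stat] assms(1,2) stat
    by (auto simp: reset_stationary_def)
  then have fin: "AE \<omega> in N. 0 \<le> W \<omega> \<and> W \<omega> < \<infinity>"
    unfolding \<nu>_def by (simp add: AE_distr_iff)

  \<comment> \<open>For \<open>t \<ge> 0\<close> the two events differ where \<open>W\<close> is
    \<open>\<infinity>\<close>, because \<open>real_of_ereal\<close> gives \<open>0\<close> there;
    \<open>fin\<close> makes this a null set.\<close>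
  have cdf_\<rho>: "cdf \<rho> t = measure N {\<omega> \<in> space N. W \<omega> \<le> ereal t}" for t
  proof -
    have "cdf \<rho> t = measure N {\<omega> \<in> space N. real_of_ereal (W \<omega>) \<le> t}"
      unfolding cdf_def \<rho>_W by (subst measure_distr) (auto intro!: arg_cong[where f="measure N"])
    also have "\<dots> = measure N {\<omega> \<in> space N. W \<omega> \<le> ereal t}"
    proof (rule N.finite_measure_eq_AE)
      show "AE \<omega> in N. \<omega> \<in> {\<omega> \<in> space N. real_of_ereal (W \<omega>) \<le> t} \<longleftrightarrow>
          \<omega> \<in> {\<omega> \<in> space N. W \<omega> \<le> ereal t}"
        using fin
      proof eventually_elim
        case (elim \<omega>)
        then show ?case by (cases "W \<omega>") auto
      qed
    qed measurable
    finally show ?thesis .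
  qed
  have cdf_eq: "cdf \<rho> t = q * cdf (return borel 0) t + (1 - q) * cdf (\<rho> \<star> \<mu>) t" for t
    using renewal[of "indicator {..t} :: real \<Rightarrow> real"]
    by (simp add: cdf_def measure_return indicator_def)
  have sums: "(\<lambda>k. q * (1 - q) ^ k * cdf_conv_power (cdf \<mu>) k t) sums
      measure N {\<omega> \<in> space N. W \<omega> \<le> ereal t}" for t
    using renewal_cdf_sums[OF assms(1,2) \<mu> \<rho> cdf_eq]
    by (simp add: cdf_conv_power_cdf[OF \<mu>] cdf_\<rho>)

  have char_eq: "\<psi> \<theta> = of_real q + of_real (1 - q) * (\<psi> \<theta> * \<phi> \<theta>)" for \<theta>
  proof -
    \<comment> \<open>The renewal equation tested on the exponential, which has norm
      \<open>1\<close> and equals \<open>1\<close> at the origin.\<close>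
    have "char \<rho> \<theta> = of_real q + of_real (1 - q) * char (\<rho> \<star> \<mu>) \<theta>"
      unfolding char_def by (subst renewal) (auto simp: scaleR_conv_of_real)
    then show ?thesis
      unfolding char_convolution[OF \<rho> \<mu>] by (simp add: \<psi>_def \<phi>_def \<rho>_W \<mu>_def)
  qed
  have "norm (\<phi> \<theta>) \<le> 1" for \<theta>
    using \<mu>.cmod_char_le_1 by (simp add: \<phi>_def \<mu>_def)
  from geometric_mixture_char[OF assms(1,2) this char_eq] fin sums show ?thesis
    unfolding \<mu>_def by blast
qed

end
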